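(* Let $X$ be a non-trivial connected graph. Assume that $X$ satisfies the following conditions. (1) Every edge of $X$ lies on a triangle. (2) For every $x\in V(X)$, it holds that (a) every vertex at distance $2$ from $x$ has a neighbour at distance $3$ from $x$, and (b) every vertex at distance $3$ from $x$ has a neighbour at distance $4$ from $x$. Then $X$ is stable.
   Context: All graphs are finite, simple and undirected. A graph is non-trivial if it has more than one vertex. The canonical double cover $BX$ of a graph $X$ is the direct product $X\times K_2$: $V(BX)=V(X)\times\{0,1\}$ and $E(BX)=\{\{(x,0),(y,1)\}\mid \{x,y\}\in E(X)\}$. Each $\varphi\in\operatorname{Aut}(X)$ lifts to the automorphism $(x,i)\mapsto(\varphi(x),i)$ of $BX$, and $\tau:(x,i)\mapsto(x,i+1)$ (second coordinate mod $2$) is also an automorphism of $BX$; the lifts and $\tau$ generate a subgroup of $\operatorname{Aut}(BX)$ isomorphic to $\operatorname{Aut}(X)\times S_2$. The graph $X$ is stable if $\operatorname{Aut}(BX)\cong\operatorname{Aut}(X)\times S_2$, equivalently if every automorphism of $BX$ belongs to this subgroup; otherwise $X$ is unstable. Distance is the usual graph distance. *)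

theory Defs
  imports
    "Graph_Theory.Digraph_Component"
    "Graph_Theory.Shortest_Path"
    "HOL-Algebra.Bij"
    "HOL-Algebra.Sym_Groups"
begin

text \<open>
  A finite simple undirected graph is a \<^locale>\<open>pair_graph\<close>: an undirected edge
  \<open>{x, y}\<close> is represented by the two arcs \<open>(x, y)\<close> and \<open>(y, x)\<close>.
\<close>

definition gdist :: "'a pair_pre_digraph \<Rightarrow> 'a \<Rightarrow> 'a \<Rightarrow> ereal" where
  "gdist G u v = wf_digraph.\<mu> (with_proj G) (\<lambda>_. 1) u v"

text \<open>
  As in \<^const>\<open>BijGroup\<close>, automorphisms are extensional (\<^const>\<open>undefined\<close> off the
  vertex set), so that distinct group elements are distinct automorphisms.
\<close>

definition graph_auts :: "'a pair_pre_digraph \<Rightarrow> ('a \<Rightarrow> 'a) set" where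
  "graph_auts G = {f \<in> Bij (pverts G).
     \<forall>x \<in> pverts G. \<forall>y \<in> pverts G. (f x, f y) \<in> parcs G \<longleftrightarrow> (x, y) \<in> parcs G}"

definition Aut_graph :: "'a pair_pre_digraph \<Rightarrow> ('a \<Rightarrow> 'a) monoid" where
  "Aut_graph G = BijGroup (pverts G) \<lparr>carrier := graph_auts G\<rparr>"

definition double_cover :: "'a pair_pre_digraph \<Rightarrow> ('a \<times> nat) pair_pre_digraph" where
  "double_cover X = \<lparr>
     pverts = pverts X \<times> {0, 1},
     parcs = {((x, i), (y, j)) | x i y j. (x, y) \<in> parcs X \<and> (i, j) \<in> {(0, 1), (1, 0)}}\<rparr>"

definition stable :: "'a pair_pre_digraph \<Rightarrow> bool" where
  "stable X \<longleftrightarrow> Aut_graph (double_cover X) \<cong> Aut_graph X \<times>\<times> sym_group 2"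

lemma gdist_eq_INF_length:
  assumes "pair_graph G"
  shows "gdist G u v = (INF p \<in> {p. pre_digraph.awalk (with_proj G) u p v}. ereal (length p))"
proof -
  interpret pair_graph G by fact
  have "awalk_cost (\<lambda>_. 1) p = length p" for p :: "('a \<times> 'a) list"
    by (induction p) (auto simp: awalk_cost_def)
  then show ?thesis
    unfolding gdist_def \<mu>_def by simp
qed

lemma pair_graph_double_cover:
  assumes "pair_graph X"
  shows "pair_graph (double_cover X)"
proof -
  interpret pair_graph X by fact
  have "finite (pverts X \<times> {0, 1 :: nat})"
    by simp
  moreover have "parcs (double_cover X) \<subseteq> (pverts X \<times> {0, 1}) \<times> (pverts X \<times> {0, 1})"
    by (auto simp: double_cover_def dest: wellformed')
  ultimately have "finite (parcs (double_cover X))"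
    by (meson finite_SigmaI finite_subset)
  moreover have "(y, x) \<in> parcs X" if "(x, y) \<in> parcs X" for x y
    using that pair_sym_arcs by (auto simp: symmetric_def sym_def)
  ultimately show ?thesis
    by unfold_locales
      (auto simp: double_cover_def symmetric_def sym_def dest: wellformed' pair_no_loops)
qed

lemma group_Aut_graph: "group (Aut_graph G)"
proof -
  let ?V = "pverts G"
  have inv: "(\<lambda>x \<in> ?V. inv_into ?V f x) \<in> graph_auts G" if f: "f \<in> graph_auts G" for f
  proof -
    from f have B: "f \<in> Bij ?V" and im: "f ` ?V = ?V"
      and adj: "\<And>x y. \<lbrakk>x \<in> ?V; y \<in> ?V\<rbrakk> \<Longrightarrow> (f x, f y) \<in> parcs G \<longleftrightarrow> (x, y) \<in> parcs G"
      by (auto simp: graph_auts_def Bij_def bij_betw_def)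
    have "(inv_into ?V f x, inv_into ?V f y) \<in> parcs G \<longleftrightarrow> (x, y) \<in> parcs G"
      if "x \<in> ?V" "y \<in> ?V" for x y
      using adj[of "inv_into ?V f x" "inv_into ?V f y"] that im
      by (metis f_inv_into_f inv_into_into)
    with B show ?thesis
      by (simp add: graph_auts_def restrict_inv_into_Bij)
  qed
  have "subgroup (graph_auts G) (BijGroup ?V)"
  proof (rule group.subgroupI[OF group_BijGroup])
    show "graph_auts G \<subseteq> carrier (BijGroup ?V)"
      by (auto simp: graph_auts_def BijGroup_def)
    show "graph_auts G \<noteq> {}"
      using id_Bij by (fastforce simp: graph_auts_def)
    show "inv\<^bsub>BijGroup ?V\<^esub> f \<in> graph_auts G" if "f \<in> graph_auts G" for f
      using that inv by (auto simp: inv_BijGroup graph_auts_def)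
    show "f \<otimes>\<^bsub>BijGroup ?V\<^esub> g \<in> graph_auts G"
      if "f \<in> graph_auts G" "g \<in> graph_auts G" for f g
    proof -
      from that have "g x \<in> ?V" if "x \<in> ?V" for x
        using that by (auto simp: graph_auts_def dest: Bij_imp_funcset)
      with that show ?thesis
        by (auto simp: graph_auts_def BijGroup_def compose_Bij compose_eq)
    qed
  qed
  then show ?thesis
    unfolding Aut_graph_def
    by (rule group.subgroup_imp_group[OF group_BijGroup])
qed

end

theory Submission
  imports Defs
begin

text \<open>
  In the double cover, \<open>v = (x, 1 - i)\<close> is the only vertex that is not adjacent to \<open>u = (x, i)\<close>,
  is joined to \<open>u\<close> by a walk of length 3, and all of whose neighbours are joined to \<open>u\<close> by walks of
  length 2. Indeed the triangle condition gives \<open>(x, 1 - i)\<close> these properties. Any other vertex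
  reached from \<open>u\<close> by a walk of length 3 is some \<open>(y, 1 - i)\<close> with \<open>y\<close> at distance 1, 2 or 3 from
  \<open>x\<close>; in the first case it is adjacent to \<open>u\<close>, in the others \<open>y\<close> has a neighbour at distance 3 or
  4 from \<open>x\<close>. Hence every automorphism of the double cover permutes the fibres \<open>{(x, 0), (x, 1)}\<close>,
  and since the graph is connected it flips either all of them or none.
\<close>

section \<open>Walks and distances as relational powers of the arc set\<close>

lemma relpow_2I: "(a, b) \<in> r \<Longrightarrow> (b, c) \<in> r \<Longrightarrow> (a, c) \<in> r ^^ 2"
  by (auto simp: numeral_2_eq_2)

lemma relpow_3I: "(a, b) \<in> r \<Longrightarrow> (b, c) \<in> r \<Longrightarrow> (c, d) \<in> r \<Longrightarrow> (a, d) \<in> r ^^ 3"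
  by (auto simp: numeral_3_eq_3)

text \<open>Distances are infima over arc lists, whereas relational powers are easier to map through
  automorphisms and to project from the cover. The vertex hypothesis matters at
  \<open>n = 0\<close>: the empty walk exists only at a vertex.\<close>

lemma relpow_parcs_iff_awalk:
  assumes "pair_graph G" and "u \<in> pverts G"
  shows "(u, v) \<in> parcs G ^^ n \<longleftrightarrow>
    (\<exists>p. pre_digraph.awalk (with_proj G) u p v \<and> length p = n)"
proof -
  interpret pair_graph G by fact
  show ?thesis
    using assms(2)
  proof (induction n arbitrary: u)
    case 0
    then show ?case
      by (auto simp: awalk_Nil_iff)
  next
    case (Suc n)
    \<comment> \<open>A relational power unfolds at its last arc, an arc list at its head; the first
      arc is split off on both sides.\<close>
    have "(u, v) \<in> parcs G ^^ Suc n \<longleftrightarrow> (\<exists>w. (u, w) \<in> parcs G \<and> (w, v) \<in> parcs G ^^ n)"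
      by (meson relpow_Suc_D2 relpow_Suc_I2)
    also have "\<dots> \<longleftrightarrow> (\<exists>w p. (u, w) \<in> parcs G \<and> awalk w p v \<and> length p = n)"
      using Suc.IH by (metis wellformed'(2))
    also have "\<dots> \<longleftrightarrow> (\<exists>p. awalk u p v \<and> length p = Suc n)"
    proof
      assume "\<exists>w p. (u, w) \<in> parcs G \<and> awalk w p v \<and> length p = n"
      then obtain w p where "(u, w) \<in> parcs G" "awalk w p v" "length p = n"
        by blast
      then have "awalk u ((u, w) # p) v" "length ((u, w) # p) = Suc n"
        by (auto simp: awalk_Cons_iff)
      then show "\<exists>p. awalk u p v \<and> length p = Suc n"
        by blast
    next
      assume "\<exists>p. awalk u p v \<and> length p = Suc n"
      then obtain e p where "awalk u (e # p) v" "length p = n"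
        by (auto simp: length_Suc_conv)
      then show "\<exists>w p. (u, w) \<in> parcs G \<and> awalk w p v \<and> length p = n"
        by (cases e) (auto simp: awalk_Cons_iff)
    qed
    finally show ?case .
  qed
qed

lemma gdist_le_relpow:
  assumes "pair_graph G" and "u \<in> pverts G" and "(u, v) \<in> parcs G ^^ n"
  shows "gdist G u v \<le> ereal n"
proof -
  obtain p where "pre_digraph.awalk (with_proj G) u p v" "length p = n"
    using assms by (auto simp: relpow_parcs_iff_awalk)
  then show ?thesis
    by (auto simp: gdist_eq_INF_length[OF assms(1)] intro!: INF_lower2)
qed

text \<open>Some walk exists, so there is a least walk length, and the infimum defining the distance
  is attained there. This permits a case analysis on a natural number \<open>m\<close>.\<close>

lemma gdist_relpow_attained:
  assumes "pair_graph G" and "u \<in> pverts G" and "(u, v) \<in> parcs G ^^ n"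
  obtains m where "m \<le> n" and "gdist G u v = ereal m" and "(u, v) \<in> parcs G ^^ m"
proof -
  define m where "m = (LEAST m. (u, v) \<in> parcs G ^^ m)"
  have m: "(u, v) \<in> parcs G ^^ m" and least: "m \<le> k" if "(u, v) \<in> parcs G ^^ k" for k
    using that unfolding m_def by (auto intro: LeastI Least_le)
  have "m \<le> length p" if "pre_digraph.awalk (with_proj G) u p v" for p
    using least that relpow_parcs_iff_awalk[OF assms(1,2)] by blast
  then have "ereal m \<le> gdist G u v"
    unfolding gdist_eq_INF_length[OF assms(1)] by (auto intro!: INF_greatest)
  then have "gdist G u v = ereal m"
    using gdist_le_relpow[OF assms(1,2) m[OF assms(3)]] by simp
  with m least assms(3) that show ?thesis
    by blast
qed

lemma connected_imp_rtrancl: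
  assumes "pair_graph X" and "connected X" and "x \<in> pverts X" and "y \<in> pverts X"
  shows "(x, y) \<in> (parcs X)\<^sup>*"
proof -
  interpret pair_graph X by fact
  have "x \<rightarrow>\<^sup>*\<^bsub>with_proj X\<^esub> y"
    using symmetric_connected_imp_strongly_connected[OF sym_arcs assms(2)] assms(3,4)
    by (auto simp: strongly_connected_def)
  then show ?thesis
    by (simp add: reachable_def rtrancl_on_rtranclI)
qed

section \<open>Embedding Aut(X) x S_2 into the automorphisms of the double cover\<close>

lemma permutes_1_2_iff:
  "p permutes {Suc 0..2} \<longleftrightarrow> p = id \<or> p = Transposition.transpose (Suc 0) 2"
proof
  assume "p permutes {Suc 0..2}"
  moreover have eq: "{Suc 0..2} = {Suc 0, 2}"
    by auto
  ultimately have p: "p permutes {Suc 0, 2}"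
    by simp
  have "p (Suc 0) \<in> {Suc 0, 2}" "p 2 \<in> {Suc 0, 2}"
    using permutes_in_image[OF p] by blast+
  moreover have "p (Suc 0) \<noteq> p 2"
    using inj_eq[OF permutes_inj[OF p], of "Suc 0" 2] by simp
  moreover have off: "p i = i" if "i \<notin> {Suc 0, 2}" for i
    using p that by (rule permutes_not_in)
  ultimately consider "p (Suc 0) = Suc 0" "p 2 = 2" | "p (Suc 0) = 2" "p 2 = Suc 0"
    by auto
  then show "p = id \<or> p = Transposition.transpose (Suc 0) 2"
  proof cases
    case 1
    then have "p i = i" for i
      using off by (cases "i \<in> {Suc 0, 2}") auto
    then show ?thesis
      by auto
  next
    case 2
    then have "p i = Transposition.transpose (Suc 0) 2 i" for i
      using off by (cases "i \<in> {Suc 0, 2}") auto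
    then show ?thesis
      by auto
  qed
qed (auto intro: permutes_swap_id)

lemma parcs_double_cover [simp]:
  "((x, i), (y, j)) \<in> parcs (double_cover X) \<longleftrightarrow>
    (x, y) \<in> parcs X \<and> (i = 0 \<and> j = 1 \<or> i = 1 \<and> j = 0)"
  by (auto simp: double_cover_def)

lemma pverts_double_cover [simp]: "pverts (double_cover X) = pverts X \<times> {0, 1}"
  by (simp add: double_cover_def)

text \<open>The symmetric group acts on \<open>{1, 2}\<close>, the layers of the double cover are 0 and 1.\<close>

definition cover_aut ::
  "'a pair_pre_digraph \<Rightarrow> ('a \<Rightarrow> 'a) \<times> (nat \<Rightarrow> nat) \<Rightarrow> 'a \<times> nat \<Rightarrow> 'a \<times> nat" where
  "cover_aut X = (\<lambda>(f, p). \<lambda>(x, i) \<in> pverts X \<times> {0, 1}. (f x, p (Suc i) - 1))"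

lemma cover_aut_in_graph_auts:
  assumes "f \<in> graph_auts X" and "p permutes {1..2}"
  shows "cover_aut X (f, p) \<in> graph_auts (double_cover X)"
proof -
  have inj: "inj_on f (pverts X)" and im: "f ` pverts X = pverts X"
    and adj: "\<And>x y. \<lbrakk>x \<in> pverts X; y \<in> pverts X\<rbrakk> \<Longrightarrow> (f x, f y) \<in> parcs X \<longleftrightarrow> (x, y) \<in> parcs X"
    using assms(1) by (auto simp: graph_auts_def Bij_def bij_betw_def)
  have p: "p = id \<or> p = Transposition.transpose (Suc 0) 2"
    using assms(2) by (simp add: permutes_1_2_iff)
  let ?h = "\<lambda>i. p (Suc i) - 1"
  have "bij_betw (map_prod f ?h) (pverts X \<times> {0, 1}) (pverts X \<times> {0, 1})"
    using inj im p
    by (intro bij_betw_map_prod) (auto simp: bij_betw_def Transposition.transpose_def)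
  then have "bij_betw (cover_aut X (f, p)) (pverts X \<times> {0, 1}) (pverts X \<times> {0, 1})"
    by (rule bij_betw_cong[THEN iffD1, rotated]) (auto simp: cover_aut_def)
  moreover have "cover_aut X (f, p) \<in> extensional (pverts X \<times> {0, 1})"
    by (simp add: cover_aut_def)
  moreover have "(cover_aut X (f, p) (x, i), cover_aut X (f, p) (y, j)) \<in> parcs (double_cover X)
      \<longleftrightarrow> ((x, i), (y, j)) \<in> parcs (double_cover X)"
    if "x \<in> pverts X" "y \<in> pverts X" "i \<in> {0, 1}" "j \<in> {0, 1}" for x y i j
    using p that adj[OF that(1,2)]
    by (elim disjE insertE) (simp_all add: cover_aut_def Transposition.transpose_def)
  ultimately show ?thesis
    unfolding graph_auts_def Bij_def pverts_double_cover by blast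
qed

lemma cover_aut_mult:
  assumes "f \<in> graph_auts X" "g \<in> graph_auts X" "p permutes {1..2}" "q permutes {1..2}"
  shows "cover_aut X (compose (pverts X) f g, p \<circ> q) =
    compose (pverts (double_cover X)) (cover_aut X (f, p)) (cover_aut X (g, q))"
proof -
  have "g x \<in> pverts X" if "x \<in> pverts X" for x
    using assms(2) that by (auto simp: graph_auts_def Bij_def bij_betw_def)
  \<comment> \<open>In the composite, \<open>q (Suc i) - 1\<close> is shifted up again before
    \<open>p\<close> is applied. The two cases for \<open>q\<close> show that
    \<open>q (Suc i)\<close> is positive, so truncated subtraction loses nothing.\<close>
  moreover have "q = id \<or> q = Transposition.transpose (Suc 0) 2"
    using assms(4) by (simp add: permutes_1_2_iff)
  ultimately show ?thesis
    by (auto simp: cover_aut_def compose_def Transposition.transpose_def fun_eq_iff numeral_2_eq_2)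
qed

text \<open>The values on layer 0 determine \<open>f\<close> and the image of 1 under
  \<open>p\<close>, hence \<open>p\<close>. A vertex is needed to read off \<open>p\<close>: over
  the empty graph both permutations give the same map.\<close>

lemma inj_on_cover_aut:
  assumes "pverts X \<noteq> {}"
  shows "inj_on (cover_aut X) (graph_auts X \<times> {p. p permutes {1..2}})"
proof (rule inj_onI, clarify)
  fix f p g q
  assume fg: "f \<in> graph_auts X" "g \<in> graph_auts X"
    and pq: "p permutes {1..2}" "q permutes {1..2}"
    and eq: "cover_aut X (f, p) = cover_aut X (g, q)"
  have *: "f x = g x \<and> p (Suc 0) - 1 = q (Suc 0) - 1" if "x \<in> pverts X" for x
    using fun_cong[OF eq, of "(x, 0)"] that by (simp add: cover_aut_def)
  have "f = g"
    using fg * by (intro extensionalityI[of f "pverts X"]) (auto simp: graph_auts_def Bij_def)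
  moreover have "p = q"
    using * assms pq by (auto simp: permutes_1_2_iff Transposition.transpose_def)
  ultimately show "f = g \<and> p = q"
    by simp
qed

section \<open>Automorphisms that permute the fibres\<close>

text \<open>Such an automorphism induces a map \<open>f\<close> on fibres and a flip bit
  \<open>c x\<close> at each vertex. Arcs of the cover join different layers, so \<open>c\<close>
  agrees at adjacent vertices and is constant by connectedness.\<close>

lemma graph_auts_double_cover_eq_cover_aut:
  assumes graph: "pair_graph X" and conn: "connected X"
    and phi: "\<phi> \<in> graph_auts (double_cover X)"
    and fibre: "\<And>x. x \<in> pverts X \<Longrightarrow> \<exists>y. {\<phi> (x, 0), \<phi> (x, 1)} = {(y, 0), (y, 1)}"
  shows "\<phi> \<in> cover_aut X ` (graph_auts X \<times> {p. p permutes {1..2}})"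
proof -
  interpret pair_graph X by fact
  let ?V = "pverts X"
  have inj: "inj_on \<phi> (?V \<times> {0, 1})" and im: "\<phi> ` (?V \<times> {0, 1}) = ?V \<times> {0, 1}"
    and ext: "\<phi> \<in> extensional (?V \<times> {0, 1})"
    and adj: "\<And>u v. \<lbrakk>u \<in> ?V \<times> {0, 1}; v \<in> ?V \<times> {0, 1}\<rbrakk> \<Longrightarrow>
      (\<phi> u, \<phi> v) \<in> parcs (double_cover X) \<longleftrightarrow> (u, v) \<in> parcs (double_cover X)"
    using phi unfolding graph_auts_def Bij_def bij_betw_def pverts_double_cover by blast+
  define f where "f = (\<lambda>x \<in> ?V. fst (\<phi> (x, 0)))"
  define c where "c x = snd (\<phi> (x, 0))" for x
  \<comment> \<open>The fibre hypothesis concerns unordered pairs, so either order of layers may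
    occur; since \<open>c x\<close> is 0 or 1, \<open>1 - c x\<close> is the other layer.\<close>
  have phi_eq: "\<phi> (x, 0) = (f x, c x) \<and> \<phi> (x, 1) = (f x, 1 - c x) \<and> c x \<in> {0, 1} \<and> f x \<in> ?V"
    if x: "x \<in> ?V" for x
  proof -
    have "\<phi> (x, 0) \<in> ?V \<times> {0, 1}"
      using im x by blast
    with fibre[OF x] x show ?thesis
      by (auto simp: f_def c_def doubleton_eq_iff)
  qed
  have c_arc: "c x = c y" if "(x, y) \<in> parcs X" for x y
  proof -
    have V: "x \<in> ?V" "y \<in> ?V"
      using that wellformed' by auto
    \<comment> \<open>This image arc ends in layers \<open>c x\<close> and \<open>1 - c y\<close>,
      which must differ.\<close>
    then have "(\<phi> (x, 0), \<phi> (y, 1)) \<in> parcs (double_cover X)"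
      using adj that by simp
    with phi_eq[OF V(1)] phi_eq[OF V(2)] show ?thesis
      by auto
  qed
  have c_const: "c x = c y" if "x \<in> ?V" "y \<in> ?V" for x y
    using connected_imp_rtrancl[OF graph conn that]
    by (induction rule: rtrancl_induct) (auto dest: c_arc)
  obtain x0 where x0: "x0 \<in> ?V"
    using conn by (auto simp: connected_def strongly_connected_def)
  have c: "c x = c x0" if "x \<in> ?V" for x
    using c_const[OF that x0] .
  have "inj_on f ?V"
  proof (rule inj_onI)
    fix x y
    assume "x \<in> ?V" "y \<in> ?V" "f x = f y"
    then have "\<phi> (x, 0) = \<phi> (y, 0)"
      using phi_eq c by simp
    with \<open>x \<in> ?V\<close> \<open>y \<in> ?V\<close> inj show "x = y"
      by (auto dest: inj_onD)
  qed
  moreover have "f ` ?V = ?V"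
  proof (intro equalityI subsetI)
    fix y
    assume "y \<in> ?V"
    then have "(y, 0) \<in> \<phi> ` (?V \<times> {0, 1})"
      using im by simp
    then obtain x i where "x \<in> ?V" "i \<in> {0, 1}" "\<phi> (x, i) = (y, 0)"
      by force
    with phi_eq[of x] show "y \<in> f ` ?V"
      by auto
  qed (use phi_eq in auto)
  moreover have "(f x, f y) \<in> parcs X \<longleftrightarrow> (x, y) \<in> parcs X" if "x \<in> ?V" "y \<in> ?V" for x y
    using adj[of "(x, 0)" "(y, 1)"] that phi_eq[of x] phi_eq[of y] c[of x] c[of y] by auto
  ultimately have f: "f \<in> graph_auts X"
    by (auto simp: graph_auts_def Bij_def bij_betw_def f_def)
  define p where "p = (if c x0 = 0 then id else Transposition.transpose 1 (2::nat))"
  have "\<phi> (x, i) = cover_aut X (f, p) (x, i)" if "x \<in> ?V" "i \<in> {0, 1}" for x i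
    using that phi_eq[of x] c[of x]
    by (auto simp: cover_aut_def p_def Transposition.transpose_def)
  then have "\<phi> = cover_aut X (f, p)"
    using ext by (intro extensionalityI[of _ "?V \<times> {0, 1}"]) (auto simp: cover_aut_def)
  moreover have "p permutes {1..2}"
    by (simp add: permutes_1_2_iff p_def)
  ultimately show ?thesis
    using f by blast
qed

text \<open>\<open>cover_aut X\<close> is an injective homomorphism; the fibre hypothesis makes it
  onto. The resulting isomorphism runs opposite to the one in \<open>stable\<close> and is inverted
  at the end.\<close>

lemma stable_if_fibres_preserved:
  assumes graph: "pair_graph X" and conn: "connected X"
    and fibre: "\<And>\<phi> x. \<lbrakk>\<phi> \<in> graph_auts (double_cover X); x \<in> pverts X\<rbrakk> \<Longrightarrow>
      \<exists>y. {\<phi> (x, 0), \<phi> (x, 1)} = {(y, 0), (y, 1)}"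
  shows "stable X"
proof -
  let ?P = "Aut_graph X \<times>\<times> sym_group 2"
  have carrier: "carrier ?P = graph_auts X \<times> {p. p permutes {1..2}}"
    by (simp add: DirProd_def Aut_graph_def sym_group_def)
  have "cover_aut X \<in> hom ?P (Aut_graph (double_cover X))"
  proof (rule homI)
    fix a
    assume "a \<in> carrier ?P"
    then show "cover_aut X a \<in> carrier (Aut_graph (double_cover X))"
      unfolding carrier by (auto simp: Aut_graph_def cover_aut_in_graph_auts)
  next
    fix a b
    assume "a \<in> carrier ?P" "b \<in> carrier ?P"
    then obtain f p g q where ab: "a = (f, p)" "b = (g, q)"
      and mem: "f \<in> graph_auts X" "g \<in> graph_auts X" "p permutes {1..2}" "q permutes {1..2}"
      unfolding carrier by blast
    \<comment> \<open>The product of \<open>BijGroup\<close> is composition only for arguments in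
      \<open>Bij\<close>, so membership is needed to unfold it.\<close>
    have "f \<in> Bij (pverts X)" "g \<in> Bij (pverts X)"
      "cover_aut X a \<in> Bij (pverts (double_cover X))"
      "cover_aut X b \<in> Bij (pverts (double_cover X))"
      using mem cover_aut_in_graph_auts unfolding ab graph_auts_def by blast+
    with cover_aut_mult[OF mem] ab
    show "cover_aut X (a \<otimes>\<^bsub>?P\<^esub> b) =
      cover_aut X a \<otimes>\<^bsub>Aut_graph (double_cover X)\<^esub> cover_aut X b"
      by (simp add: Aut_graph_def BijGroup_def sym_group_def del: pverts_double_cover)
  qed
  moreover have "bij_betw (cover_aut X) (carrier ?P) (carrier (Aut_graph (double_cover X)))"
    unfolding bij_betw_def
  proof
    have "pverts X \<noteq> {}"
      using conn by (auto simp: connected_def strongly_connected_def)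
    then show "inj_on (cover_aut X) (carrier ?P)"
      unfolding carrier by (rule inj_on_cover_aut)
    show "cover_aut X ` carrier ?P = carrier (Aut_graph (double_cover X))"
      unfolding carrier
      using cover_aut_in_graph_auts
        graph_auts_double_cover_eq_cover_aut[OF graph conn] fibre
      by (auto simp: Aut_graph_def)
  qed
  ultimately have "?P \<cong> Aut_graph (double_cover X)"
    by (intro is_isoI isoI)
  moreover have "group ?P"
    by (intro DirProd_group group_Aut_graph sym_group_is_group)
  ultimately show ?thesis
    unfolding stable_def by (rule group.iso_sym[rotated])
qed

section \<open>Recognising the fibres by walks\<close>

text \<open>Only arcs and walk lengths occur, never the coordinates of a cover vertex, so the
  relation is invariant under automorphisms.\<close>

definition antipodal :: "'a pair_pre_digraph \<Rightarrow> 'a \<Rightarrow> 'a \<Rightarrow> bool" where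
  "antipodal G u v \<longleftrightarrow> (u, v) \<notin> parcs G \<and> (u, v) \<in> parcs G ^^ 3 \<and>
    (\<forall>w. (v, w) \<in> parcs G \<longrightarrow> (u, w) \<in> parcs G ^^ 2)"

lemma antipodal_graph_auts:
  assumes "pair_graph G" and "\<phi> \<in> graph_auts G" and "u \<in> pverts G" and "antipodal G u v"
  shows "antipodal G (\<phi> u) (\<phi> v)"
proof -
  interpret pair_graph G by fact
  have im: "\<phi> ` pverts G = pverts G"
    and adj: "\<And>x y. \<lbrakk>x \<in> pverts G; y \<in> pverts G\<rbrakk> \<Longrightarrow>
      (\<phi> x, \<phi> y) \<in> parcs G \<longleftrightarrow> (x, y) \<in> parcs G"
    using assms(2) by (auto simp: graph_auts_def Bij_def bij_betw_def)
  \<comment> \<open>The second conjunct keeps endpoints in the vertex set; it also yields that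
    \<open>v\<close> is a vertex, which \<open>antipodal\<close> does not state.\<close>
  have pow: "(\<phi> x, \<phi> y) \<in> parcs G ^^ n \<and> y \<in> pverts G"
    if "(x, y) \<in> parcs G ^^ n" "x \<in> pverts G" for x y n
    using that
  proof (induction n arbitrary: y)
    case (Suc n)
    then obtain z where z: "(x, z) \<in> parcs G ^^ n" "(z, y) \<in> parcs G"
      by (blast elim: relpow_Suc_E)
    moreover have "z \<in> pverts G" "y \<in> pverts G"
      using z(2) wellformed' by auto
    ultimately show ?case
      using Suc.IH Suc.prems adj by (blast intro: relpow_Suc_I)
  qed simp
  have v: "v \<in> pverts G"
    using pow assms(3,4) unfolding antipodal_def by blast
  have "(\<phi> u, w) \<in> parcs G ^^ 2" if w: "(\<phi> v, w) \<in> parcs G" for w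
  proof -
    \<comment> \<open>Surjectivity pulls a neighbour of \<open>\<phi> v\<close> back to a neighbour
      of \<open>v\<close>.\<close>
    obtain w' where "w' \<in> pverts G" "w = \<phi> w'"
      using w wellformed' im by blast
    with w v assms(3,4) adj pow show ?thesis
      unfolding antipodal_def by blast
  qed
  with v assms(3,4) adj pow show ?thesis
    unfolding antipodal_def by blast
qed

text \<open>Every arc of the cover projects to an arc of \<open>X\<close> and switches the layer, so
  the parity of the length fixes the final layer.\<close>

lemma relpow_double_coverD:
  "((x, i), (y, j)) \<in> parcs (double_cover X) ^^ n \<Longrightarrow> i \<in> {0, 1} \<Longrightarrow>
    (x, y) \<in> parcs X ^^ n \<and> j = (i + n) mod 2"
proof (induction n arbitrary: y j)
  case (Suc n)
  then obtain z k where "((x, i), (z, k)) \<in> parcs (double_cover X) ^^ n"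
    and "((z, k), (y, j)) \<in> parcs (double_cover X)"
    by (force elim: relpow_Suc_E)
  with Suc show ?case
    by (fastforce intro: relpow_Suc_I simp: mod_Suc)
qed auto

lemma antipodal_double_cover_iff:
  assumes graph: "pair_graph X"
    and nontrivial: "card (pverts X) > 1"
    and conn: "connected X"
    and triangle: "\<And>x y. (x, y) \<in> parcs X \<Longrightarrow> \<exists>z. (x, z) \<in> parcs X \<and> (y, z) \<in> parcs X"
    and dist2: "\<And>x y. \<lbrakk>x \<in> pverts X; y \<in> pverts X; gdist X x y = 2\<rbrakk>
      \<Longrightarrow> \<exists>z. (y, z) \<in> parcs X \<and> gdist X x z = 3"
    and dist3: "\<And>x y. \<lbrakk>x \<in> pverts X; y \<in> pverts X; gdist X x y = 3\<rbrakk>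
      \<Longrightarrow> \<exists>z. (y, z) \<in> parcs X \<and> gdist X x z = 4"
    and x: "x \<in> pverts X" and i: "i \<in> {0, 1}"
  shows "antipodal (double_cover X) (x, i) v \<longleftrightarrow> v = (x, 1 - i)"
proof -
  interpret pair_graph X by fact
  have arc_sym: "(b, a) \<in> parcs X" if "(a, b) \<in> parcs X" for a b
    using that pair_sym_arcs by (auto simp: symmetric_def sym_def)
  show ?thesis
  proof
    assume a: "antipodal (double_cover X) (x, i) v"
    obtain y j where "v = (y, j)"
      by (cases v)
    moreover have "((x, i), v) \<in> parcs (double_cover X) ^^ 3"
      using a by (simp add: antipodal_def)
    ultimately have walk: "(x, y) \<in> parcs X ^^ 3" and v: "v = (y, 1 - i)"
      using relpow_double_coverD[of x i y j 3] i by auto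
    have y: "y \<in> pverts X"
      using walk wellformed' by (auto simp: numeral_eq_Suc)
    \<comment> \<open>A neighbour \<open>z\<close> of \<open>y\<close> lifts to the neighbour
      \<open>(z, i)\<close> of \<open>v\<close>, and the walk of length 2 from \<open>(x, i)\<close>
      to it projects to \<open>X\<close>.\<close>
    have near: "gdist X x z \<le> 2" if "(y, z) \<in> parcs X" for z
    proof -
      have "((x, i), (z, i)) \<in> parcs (double_cover X) ^^ 2"
        using a that v i by (auto simp: antipodal_def)
      then show ?thesis
        using relpow_double_coverD[of x i z i 2] i gdist_le_relpow[OF graph x, of z 2] by auto
    qed
    obtain m where m: "m \<le> 3" "gdist X x y = ereal m" "(x, y) \<in> parcs X ^^ m"
      using gdist_relpow_attained[OF graph x walk] by auto
    \<comment> \<open>Otherwise the arc from \<open>x\<close> to \<open>y\<close> would lift to an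
      arc from \<open>(x, i)\<close> to \<open>v\<close>.\<close>
    have "m \<noteq> 1"
      using a v m i by (auto simp: antipodal_def)
    moreover have "m \<noteq> 2"
    proof
      assume "m = 2"
      then obtain z where "(y, z) \<in> parcs X" "gdist X x z = 3"
        using m dist2[OF x y] by auto
      with near[of z] show False
        by simp
    qed
    moreover have "m \<noteq> 3"
    proof
      assume "m = 3"
      then obtain z where "(y, z) \<in> parcs X" "gdist X x z = 4"
        using m dist3[OF x y] by auto
      with near[of z] show False
        by simp
    qed
    ultimately have "m = 0"
      using m by linarith
    with m v show "v = (x, 1 - i)"
      by simp
  next
    assume v: "v = (x, 1 - i)"
    \<comment> \<open>A second vertex and connectedness give \<open>x\<close> a neighbour, hence a
      triangle through \<open>x\<close>.\<close>
    have "\<not> pverts X \<subseteq> {x}"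
      using nontrivial card_mono[of "{x}" "pverts X"] by auto
    then obtain x' where "x' \<in> pverts X" "x' \<noteq> x"
      by blast
    then obtain y where y: "(x, y) \<in> parcs X"
      using connected_imp_rtrancl[OF graph conn x] by (metis converse_rtranclE)
    then obtain z where z: "(x, z) \<in> parcs X" "(y, z) \<in> parcs X"
      using triangle by blast
    \<comment> \<open>Going once around the triangle takes three steps, an odd number, so the lifted
      walk ends in the other vertex over \<open>x\<close>.\<close>
    with y i v arc_sym[OF z(1)] have
      "((x, i), (y, 1 - i)) \<in> parcs (double_cover X)"
      "((y, 1 - i), (z, i)) \<in> parcs (double_cover X)"
      "((z, i), v) \<in> parcs (double_cover X)"
      by auto
    then have "((x, i), v) \<in> parcs (double_cover X) ^^ 3"
      by (rule relpow_3I)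
    moreover have "((x, i), w) \<in> parcs (double_cover X) ^^ 2"
      if w: "(v, w) \<in> parcs (double_cover X)" for w
    proof -
      obtain z where z: "w = (z, i)" "(x, z) \<in> parcs X"
        using w i v by (cases w) auto
      \<comment> \<open>The third vertex \<open>t\<close> of a triangle on the edge from
        \<open>x\<close> to \<open>z\<close> is the midpoint of the walk of length 2.\<close>
      then obtain t where t: "(x, t) \<in> parcs X" "(z, t) \<in> parcs X"
        using triangle by blast
      with z i arc_sym[OF t(2)] have "((x, i), (t, 1 - i)) \<in> parcs (double_cover X)"
        "((t, 1 - i), w) \<in> parcs (double_cover X)"
        by auto
      then show ?thesis
        by (rule relpow_2I)
    qed
    moreover have "((x, i), v) \<notin> parcs (double_cover X)"
      using v pair_no_loops[of "(x, x)"] by auto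
    ultimately show "antipodal (double_cover X) (x, i) v"
      by (simp add: antipodal_def)
  qed
qed

theorem proposition3p2:
  fixes X :: "'a pair_pre_digraph"
  assumes graph: "pair_graph X"
    and nontrivial: "card (pverts X) > 1"
    and conn: "connected X"
    and triangle: "\<And>x y. (x, y) \<in> parcs X \<Longrightarrow> \<exists>z. (x, z) \<in> parcs X \<and> (y, z) \<in> parcs X"
    and dist2: "\<And>x y. \<lbrakk>x \<in> pverts X; y \<in> pverts X; gdist X x y = 2\<rbrakk>
      \<Longrightarrow> \<exists>z. (y, z) \<in> parcs X \<and> gdist X x z = 3"
    and dist3: "\<And>x y. \<lbrakk>x \<in> pverts X; y \<in> pverts X; gdist X x y = 3\<rbrakk>
      \<Longrightarrow> \<exists>z. (y, z) \<in> parcs X \<and> gdist X x z = 4"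
  shows "stable X"
proof (rule stable_if_fibres_preserved[OF graph conn])
  fix \<phi> x
  assume phi: "\<phi> \<in> graph_auts (double_cover X)" and x: "x \<in> pverts X"
  note anti = antipodal_double_cover_iff[OF graph nontrivial conn triangle dist2 dist3]
  have "\<phi> (x, 0) \<in> pverts X \<times> {0, 1}"
    using phi x unfolding graph_auts_def Bij_def bij_betw_def pverts_double_cover by blast
  then obtain y i where y: "\<phi> (x, 0) = (y, i)" "y \<in> pverts X" "i \<in> {0, 1}"
    by blast
  have "antipodal (double_cover X) (x, 0) (x, 1)"
    using anti[of x 0 "(x, 1)"] x by simp
  then have "antipodal (double_cover X) (y, i) (\<phi> (x, 1))"
    using antipodal_graph_auts[OF pair_graph_double_cover[OF graph] phi, of "(x, 0)" "(x, 1)"] x y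
    by simp
  \<comment> \<open>The characterisation is applied a second time, at the image vertex, where
    uniqueness identifies the partner.\<close>
  then have "\<phi> (x, 1) = (y, 1 - i)"
    using anti[of y i "\<phi> (x, 1)"] y by simp
  with y show "\<exists>y. {\<phi> (x, 0), \<phi> (x, 1)} = {(y, 0), (y, 1)}"
    by auto
qed

end
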